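(* The following identities of formal Laurent series hold: \begin{align*} \phi_{i,j}(z) & =A_{i,j}(z), \qquad i,j \ge 0,\\ \phi_{i,j}^{(1)}(z) & =A_{i,j}^{(1)}(z), \qquad i,j \ge 0,\\ \psi_{i,j}(z) & = W_{i,j}(z), \qquad i,j \in \mathbb{Z}. \end{align*}
   Context: Fix integers $p,q\geq 1$ and, for each $-p\leq k\leq q$, a bi-infinite sequence $(a^{(k)}_{n})_{n\in\mathbb{Z}}$ of complex numbers. Paths. A step is an ordered pair $(n,m)\rightarrow(n+1,m')$ with $n\in\mathbb{Z}_{\geq 0}$, $m,m'\in\mathbb{Z}$ and $-p\leq m'-m\leq q$. Its weight is $a_m^{(i)}$ if $m'=m+i$ with $0\leq i\leq q$, and $a_{m-j}^{(-j)}$ if $m'=m-j$ with $1\leq j\leq p$. A lattice path of length $k$ is a sequence of $k$ steps in which the final vertex of each step is the initial vertex of the next; a path of length zero is a single vertex. The weight $w(\gamma)$ of a path $\gamma$ is the product of the weights of its steps (and $1$ for paths of length zero). Empty sums are zero. For $n\geq 0$ and $i,j\in\mathbb{Z}$, $\mathcal{P}_{[n,i,j]}$ is the collection of all lattice paths of length $n$ with initial point $(0,i)$ and final point $(n,j)$. For $i,j\geq 0$, $\mathcal{D}_{[n,i,j]}\subset\mathcal{P}_{[n,i,j]}$ consists of the paths with no point below the $x$-axis, and $\mathcal{D}^{(1)}_{[n,i,j]}\subset\mathcal{D}_{[n,i+1,j+1]}$ consists of the paths with no point below the line $y=1$. Let $A_{[n,i,j]}$, $A^{(1)}_{[n,i,j]}$,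 $W_{[n,i,j]}$ be the sums of $w(\gamma)$ over $\gamma$ in $\mathcal{D}_{[n,i,j]}$, $\mathcal{D}^{(1)}_{[n,i,j]}$, $\mathcal{P}_{[n,i,j]}$ respectively, and $$A_{i,j}(z)=\sum_{n=0}^{\infty}\frac{A_{[n,i,j]}}{z^{n+1}},\quad A^{(1)}_{i,j}(z)=\sum_{n=0}^{\infty}\frac{A^{(1)}_{[n,i,j]}}{z^{n+1}},\quad W_{i,j}(z)=\sum_{n=0}^{\infty}\frac{W_{[n,i,j]}}{z^{n+1}}.$$ Operators. Let $\{e_n\}_{n\in\mathbb{Z}}$ be the standard basis vectors of $\ell^2(\mathbb{Z})$, with inner product $\langle\cdot,\cdot\rangle$; $\mathcal{E}=\mathrm{span}\{e_n\}_{n\in\mathbb{Z}}$ and $\mathcal{E}_0=\mathrm{span}\{e_n\}_{n\geq 0}$ (finite linear combinations). Define linear operators $\mathcal{W}:\mathcal{E}\to\mathcal{E}$ and $\mathcal{H},\mathcal{H}_1:\mathcal{E}_0\to\mathcal{E}_0$ by $$\mathcal{W}e_n=\sum_{m=1}^{q}a_{n-m}^{(m)}e_{n-m}+\sum_{m=0}^{p}a_n^{(-m)}e_{n+m},\qquad n\in\mathbb{Z},$$ $$\mathcal{H}e_n=\sum_{m=1}^{\min(n,q)}a_{n-m}^{(m)}e_{n-m}+\sum_{m=0}^{p}a_n^{(-m)}e_{n+m},\qquad n\geq 0,$$ $$\mathcal{H}_1e_n=\sum_{m=1}^{\min(n,q)}a_{n-m+1}^{(m)}e_{n-m}+\sum_{m=0}^{p}a_{n+1}^{(-m)}e_{n+m},\qquad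 n\geq 0.$$ The resolvent functions are the formal Laurent series $$\psi_{i,j}(z)=\sum_{n=0}^{\infty}\frac{\langle\mathcal{W}^ne_j,e_i\rangle}{z^{n+1}}\ (i,j\in\mathbb{Z}),\quad \phi_{i,j}(z)=\sum_{n=0}^{\infty}\frac{\langle\mathcal{H}^ne_j,e_i\rangle}{z^{n+1}},\quad \phi^{(1)}_{i,j}(z)=\sum_{n=0}^{\infty}\frac{\langle\mathcal{H}_1^ne_j,e_i\rangle}{z^{n+1}}\ (i,j\geq 0).$$ *)

theory Defs
  imports
    "HOL-Analysis.Infinite_Sum"
    "HOL-Library.Function_Algebras"
    "HOL-Computational_Algebra.Formal_Laurent_Series"
begin

text \<open>
  Throughout, \<open>a k n\<close> stands for \<open>a\<^sub>n\<^sup>(\<^sup>k\<^sup>)\<close>: the superscript comes first. Only the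
  superscripts with \<open>- p \<le> k \<le> q\<close> are ever used.
\<close>


section \<open>Formal series in the inverse of the variable\<close>

text \<open>
  The series have the form \<open>\<Sum>n. c n / z ^ (n + 1)\<close>. They are represented as formal Laurent
  series in \<open>1/z\<close>; that is, \<^const>\<open>fls_X\<close> plays the role of \<open>1/z\<close> and \<^const>\<open>fls_X_inv\<close>
  that of \<open>z\<close>.
\<close>

definition z_series :: "(nat \<Rightarrow> complex) \<Rightarrow> complex fls" where
  "z_series c = fls_X * fps_to_fls (Abs_fps c)"

lemma z_series_nth: "fls_nth (z_series c) k = (if k \<ge> 1 then c (nat (k - 1)) else 0)"
  by (simp add: z_series_def fls_X_times_conv_shift)


section \<open>Lattice paths\<close>

definition is_step :: "int \<Rightarrow> int \<Rightarrow> nat \<times> int \<Rightarrow> nat \<times> int \<Rightarrow> bool" where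
  "is_step p q u v \<longleftrightarrow> fst v = fst u + 1 \<and> - p \<le> snd v - snd u \<and> snd v - snd u \<le> q"

definition step_weight :: "(int \<Rightarrow> int \<Rightarrow> complex) \<Rightarrow> nat \<times> int \<Rightarrow> nat \<times> int \<Rightarrow> complex" where
  "step_weight a u v =
     (let m = snd u; d = snd v - snd u in if 0 \<le> d then a d m else a d (m + d))"

text \<open>
  A path of length \<open>k\<close> is given by the list of its \<open>k + 1\<close> vertices, so that a path of length zero
  is a single vertex.
\<close>

definition lattice_path :: "int \<Rightarrow> int \<Rightarrow> (nat \<times> int) list \<Rightarrow> bool" where
  "lattice_path p q \<gamma> \<longleftrightarrow> \<gamma> \<noteq> [] \<and> (\<forall>k < length \<gamma> - 1. is_step p q (\<gamma> ! k) (\<gamma> ! Suc k))"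

definition path_length :: "(nat \<times> int) list \<Rightarrow> nat" where
  "path_length \<gamma> = length \<gamma> - 1"

definition path_weight :: "(int \<Rightarrow> int \<Rightarrow> complex) \<Rightarrow> (nat \<times> int) list \<Rightarrow> complex" where
  "path_weight a \<gamma> = (\<Prod>k < path_length \<gamma>. step_weight a (\<gamma> ! k) (\<gamma> ! Suc k))"

definition paths_P :: "int \<Rightarrow> int \<Rightarrow> nat \<Rightarrow> int \<Rightarrow> int \<Rightarrow> (nat \<times> int) list set" where
  "paths_P p q n i j =
     {\<gamma>. lattice_path p q \<gamma> \<and> path_length \<gamma> = n \<and> hd \<gamma> = (0, i) \<and> last \<gamma> = (n, j)}"

definition paths_D :: "int \<Rightarrow> int \<Rightarrow> nat \<Rightarrow> int \<Rightarrow> int \<Rightarrow> (nat \<times> int) list set" where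
  "paths_D p q n i j = {\<gamma> \<in> paths_P p q n i j. \<forall>v \<in> set \<gamma>. snd v \<ge> 0}"

definition paths_D1 :: "int \<Rightarrow> int \<Rightarrow> nat \<Rightarrow> int \<Rightarrow> int \<Rightarrow> (nat \<times> int) list set" where
  "paths_D1 p q n i j = {\<gamma> \<in> paths_D p q n (i + 1) (j + 1). \<forall>v \<in> set \<gamma>. snd v \<ge> 1}"

text \<open>The weight sums below range over finite sets.\<close>

lemma finite_paths_P: "finite (paths_P p q n i j)"
proof -
  let ?S = "{0..n} \<times> {i - int n * \<bar>p\<bar>..i + int n * \<bar>q\<bar>}"
  have "set \<gamma> \<subseteq> ?S \<and> length \<gamma> = Suc n" if "\<gamma> \<in> paths_P p q n i j" for \<gamma>
  proof -
    from that have ne: "\<gamma> \<noteq> []" and len: "length \<gamma> = Suc n" and hd: "hd \<gamma> = (0, i)"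
      and step: "\<And>k. k < n \<Longrightarrow> is_step p q (\<gamma> ! k) (\<gamma> ! Suc k)"
      by (auto simp: paths_P_def lattice_path_def path_length_def)
    have *: "fst (\<gamma> ! k) = k \<and> i - int k * \<bar>p\<bar> \<le> snd (\<gamma> ! k) \<and> snd (\<gamma> ! k) \<le> i + int k * \<bar>q\<bar>"
      if "k \<le> n" for k
      using that
    proof (induction k)
      case 0
      then show ?case using hd ne by (simp add: hd_conv_nth)
    next
      case (Suc k)
      then show ?case using step[of k] by (auto simp: is_step_def algebra_simps)
    qed
    have "\<gamma> ! k \<in> ?S" if "k \<le> n" for k
    proof -
      have "int k * \<bar>p\<bar> \<le> int n * \<bar>p\<bar>" "int k * \<bar>q\<bar> \<le> int n * \<bar>q\<bar>"
        using that by (auto intro: mult_right_mono)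
      with *[OF that] that show ?thesis by (cases "\<gamma> ! k") auto
    qed
    then show ?thesis using len by (metis in_set_conv_nth less_Suc_eq_le subsetI)
  qed
  then have "paths_P p q n i j \<subseteq> {\<gamma>. set \<gamma> \<subseteq> ?S \<and> length \<gamma> = Suc n}" by blast
  then show ?thesis by (rule finite_subset) (simp add: finite_lists_length_eq)
qed

lemma finite_paths_D: "finite (paths_D p q n i j)"
  by (simp add: paths_D_def finite_paths_P)

lemma finite_paths_D1: "finite (paths_D1 p q n i j)"
  by (simp add: paths_D1_def finite_paths_D)

definition A_sum :: "int \<Rightarrow> int \<Rightarrow> (int \<Rightarrow> int \<Rightarrow> complex) \<Rightarrow> nat \<Rightarrow> int \<Rightarrow> int \<Rightarrow> complex" where
  "A_sum p q a n i j = (\<Sum>\<gamma> \<in> paths_D p q n i j. path_weight a \<gamma>)"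

definition A1_sum :: "int \<Rightarrow> int \<Rightarrow> (int \<Rightarrow> int \<Rightarrow> complex) \<Rightarrow> nat \<Rightarrow> int \<Rightarrow> int \<Rightarrow> complex" where
  "A1_sum p q a n i j = (\<Sum>\<gamma> \<in> paths_D1 p q n i j. path_weight a \<gamma>)"

definition W_sum :: "int \<Rightarrow> int \<Rightarrow> (int \<Rightarrow> int \<Rightarrow> complex) \<Rightarrow> nat \<Rightarrow> int \<Rightarrow> int \<Rightarrow> complex" where
  "W_sum p q a n i j = (\<Sum>\<gamma> \<in> paths_P p q n i j. path_weight a \<gamma>)"

definition A_series :: "int \<Rightarrow> int \<Rightarrow> (int \<Rightarrow> int \<Rightarrow> complex) \<Rightarrow> int \<Rightarrow> int \<Rightarrow> complex fls" where
  "A_series p q a i j = z_series (\<lambda>n. A_sum p q a n i j)"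

definition A1_series :: "int \<Rightarrow> int \<Rightarrow> (int \<Rightarrow> int \<Rightarrow> complex) \<Rightarrow> int \<Rightarrow> int \<Rightarrow> complex fls" where
  "A1_series p q a i j = z_series (\<lambda>n. A1_sum p q a n i j)"

definition W_series :: "int \<Rightarrow> int \<Rightarrow> (int \<Rightarrow> int \<Rightarrow> complex) \<Rightarrow> int \<Rightarrow> int \<Rightarrow> complex fls" where
  "W_series p q a i j = z_series (\<lambda>n. W_sum p q a n i j)"


section \<open>The operators\<close>

definition scale_seq :: "complex \<Rightarrow> (int \<Rightarrow> complex) \<Rightarrow> int \<Rightarrow> complex"  (infixr "*\<^sub>s" 75) where
  "c *\<^sub>s x = (\<lambda>k. c * x k)"

global_interpretation seq: vector_space scale_seq
  by standard (auto simp: scale_seq_def fun_eq_iff algebra_simps)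

definition ell2 :: "(int \<Rightarrow> complex) set" where
  "ell2 = {x. (\<lambda>k. (cmod (x k))\<^sup>2) summable_on UNIV}"

definition ell2_inner :: "(int \<Rightarrow> complex) \<Rightarrow> (int \<Rightarrow> complex) \<Rightarrow> complex" where
  "ell2_inner x y = (\<Sum>\<^sub>\<infinity>k. x k * cnj (y k))"

definition e :: "int \<Rightarrow> int \<Rightarrow> complex" where
  "e n = (\<lambda>k. if k = n then 1 else 0)"

definition E :: "(int \<Rightarrow> complex) set" where
  "E = seq.span (range e)"

definition E0 :: "(int \<Rightarrow> complex) set" where
  "E0 = seq.span (e ` {0..})"

text \<open>
  \<open>lin_ext I b\<close> is the linear operator on the span of \<open>e n\<close>, \<open>n \<in> I\<close>, that maps \<open>e n\<close> to \<open>b n\<close>;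
  its values outside that span are irrelevant.
\<close>

definition lin_ext :: "int set \<Rightarrow> (int \<Rightarrow> int \<Rightarrow> complex) \<Rightarrow> (int \<Rightarrow> complex) \<Rightarrow> int \<Rightarrow> complex" where
  "lin_ext I b x = (\<Sum>n \<in> {n \<in> I. x n \<noteq> 0}. x n *\<^sub>s b n)"

definition op_W ::
  "int \<Rightarrow> int \<Rightarrow> (int \<Rightarrow> int \<Rightarrow> complex) \<Rightarrow> (int \<Rightarrow> complex) \<Rightarrow> int \<Rightarrow> complex" where
  "op_W p q a = lin_ext UNIV (\<lambda>n.
     (\<Sum>m \<in> {1..q}. a m (n - m) *\<^sub>s e (n - m)) + (\<Sum>m \<in> {0..p}. a (- m) n *\<^sub>s e (n + m)))"

definition op_H ::
  "int \<Rightarrow> int \<Rightarrow> (int \<Rightarrow> int \<Rightarrow> complex) \<Rightarrow> (int \<Rightarrow> complex) \<Rightarrow> int \<Rightarrow> complex" where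
  "op_H p q a = lin_ext {0..} (\<lambda>n.
     (\<Sum>m \<in> {1..min n q}. a m (n - m) *\<^sub>s e (n - m)) + (\<Sum>m \<in> {0..p}. a (- m) n *\<^sub>s e (n + m)))"

definition op_H1 ::
  "int \<Rightarrow> int \<Rightarrow> (int \<Rightarrow> int \<Rightarrow> complex) \<Rightarrow> (int \<Rightarrow> complex) \<Rightarrow> int \<Rightarrow> complex" where
  "op_H1 p q a = lin_ext {0..} (\<lambda>n.
     (\<Sum>m \<in> {1..min n q}. a m (n - m + 1) *\<^sub>s e (n - m)) +
     (\<Sum>m \<in> {0..p}. a (- m) (n + 1) *\<^sub>s e (n + m)))"

definition psi :: "int \<Rightarrow> int \<Rightarrow> (int \<Rightarrow> int \<Rightarrow> complex) \<Rightarrow> int \<Rightarrow> int \<Rightarrow> complex fls" where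
  "psi p q a i j = z_series (\<lambda>n. ell2_inner ((op_W p q a ^^ n) (e j)) (e i))"

definition phi :: "int \<Rightarrow> int \<Rightarrow> (int \<Rightarrow> int \<Rightarrow> complex) \<Rightarrow> int \<Rightarrow> int \<Rightarrow> complex fls" where
  "phi p q a i j = z_series (\<lambda>n. ell2_inner ((op_H p q a ^^ n) (e j)) (e i))"

definition phi1 :: "int \<Rightarrow> int \<Rightarrow> (int \<Rightarrow> int \<Rightarrow> complex) \<Rightarrow> int \<Rightarrow> int \<Rightarrow> complex fls" where
  "phi1 p q a i j = z_series (\<lambda>n. ell2_inner ((op_H1 p q a ^^ n) (e j)) (e i))"


subsection \<open>Adequacy of the definitions\<close>

lemma sum_seq_apply: "(\<Sum>n \<in> A. f n) k = (\<Sum>n \<in> A. f n k :: complex)"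
  by (induction A rule: infinite_finite_induct) auto

lemma span_e_iff: "x \<in> seq.span (e ` I) \<longleftrightarrow> finite {k. x k \<noteq> 0} \<and> {k. x k \<noteq> 0} \<subseteq> I"
proof
  assume "x \<in> seq.span (e ` I)"
  then show "finite {k. x k \<noteq> 0} \<and> {k. x k \<noteq> 0} \<subseteq> I"
  proof (induction rule: seq.span_induct_alt)
    case base
    then show ?case by simp
  next
    case (step c v y)
    then obtain n where n: "n \<in> I" "v = e n" by blast
    have "{k. (c *\<^sub>s v + y) k \<noteq> 0} \<subseteq> insert n {k. y k \<noteq> 0}"
      by (auto simp: n e_def scale_seq_def)
    with step n show ?case by (meson finite.insertI finite_subset insert_subset subset_trans)
  qed
next
  assume *: "finite {k. x k \<noteq> 0} \<and> {k. x k \<noteq> 0} \<subseteq> I"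
  have "x = (\<Sum>n | x n \<noteq> 0. x n *\<^sub>s e n)"
    using * by (auto simp: fun_eq_iff sum_seq_apply scale_seq_def e_def if_distrib cong: if_cong)
  also have "\<dots> \<in> seq.span (e ` I)"
    using * by (intro seq.span_sum seq.span_scale seq.span_base) auto
  finally show "x \<in> seq.span (e ` I)" .
qed

lemma E_subset_ell2: "E \<subseteq> ell2"
proof
  fix x assume "x \<in> E"
  then have "finite {k. x k \<noteq> 0}" using span_e_iff[of x UNIV] by (simp add: E_def)
  then have "(\<lambda>k. (cmod (x k))\<^sup>2) summable_on {k. x k \<noteq> 0}" by (rule summable_on_finite)
  also have "?this \<longleftrightarrow> (\<lambda>k. (cmod (x k))\<^sup>2) summable_on UNIV"
    by (rule summable_on_cong_neutral) auto
  finally show "x \<in> ell2" by (simp add: ell2_def)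
qed

lemma ell2_inner_e: "ell2_inner x (e i) = x i"
proof -
  have "ell2_inner x (e i) = (\<Sum>\<^sub>\<infinity>k \<in> {i}. x k * cnj (e i k))"
    unfolding ell2_inner_def by (rule infsum_cong_neutral) (auto simp: e_def)
  then show ?thesis by (simp add: e_def)
qed

lemma lin_ext_superset:
  assumes "finite S" "S \<subseteq> I" "{n \<in> I. x n \<noteq> 0} \<subseteq> S"
  shows "lin_ext I b x = (\<Sum>n \<in> S. x n *\<^sub>s b n)"
  unfolding lin_ext_def using assms
  by (intro sum.mono_neutral_left) (auto simp: scale_seq_def fun_eq_iff)

lemma lin_ext_e: "n \<in> I \<Longrightarrow> lin_ext I b (e n) = b n"
  by (subst lin_ext_superset[of "{n}"]) (auto simp: e_def scale_seq_def)

lemma lin_ext_linear: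
  assumes "x \<in> seq.span (e ` I)" "y \<in> seq.span (e ` I)"
  shows "lin_ext I b (x + y) = lin_ext I b x + lin_ext I b y"
    and "lin_ext I b (c *\<^sub>s x) = c *\<^sub>s lin_ext I b x"
proof -
  let ?S = "{k. x k \<noteq> 0} \<union> {k. y k \<noteq> 0}"
  have S: "finite ?S" "?S \<subseteq> I" using assms by (auto simp: span_e_iff)
  have "lin_ext I b u = (\<Sum>n \<in> ?S. u n *\<^sub>s b n)" if "u \<in> {x, y, x + y, c *\<^sub>s x}" for u
    using that by (intro lin_ext_superset S) (auto simp: scale_seq_def)
  then show "lin_ext I b (x + y) = lin_ext I b x + lin_ext I b y"
    and "lin_ext I b (c *\<^sub>s x) = c *\<^sub>s lin_ext I b x"
    by (simp_all add: seq.scale_left_distrib sum.distrib seq.scale_sum_right)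
      (simp add: scale_seq_def mult.assoc)
qed

lemma lin_ext_closed:
  assumes "\<And>n. n \<in> I \<Longrightarrow> b n \<in> seq.span V"
  shows "lin_ext I b x \<in> seq.span V"
  unfolding lin_ext_def using assms by (intro seq.span_sum seq.span_scale) auto

lemma op_W_closed: "op_W p q a x \<in> E"
  unfolding op_W_def E_def
  by (intro lin_ext_closed seq.span_add seq.span_sum seq.span_scale seq.span_base) auto

lemma op_H_closed: "op_H p q a x \<in> E0"
  unfolding op_H_def E0_def
  by (intro lin_ext_closed seq.span_add seq.span_sum seq.span_scale seq.span_base) auto

lemma op_H1_closed: "op_H1 p q a x \<in> E0"
  unfolding op_H1_def E0_def
  by (intro lin_ext_closed seq.span_add seq.span_sum seq.span_scale seq.span_base) auto

end

theory Submission
  imports Defs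
begin

text \<open>
  Splitting off the last step of a path shows that the path sums satisfy the recursion of the powers
  of a banded matrix whose \<open>(l, j)\<close> entry is the weight of the step from height \<open>l\<close> to height \<open>j\<close>;
  in each of the three cases this is the matrix of the operator. Confining the paths to a set of
  heights amounts to truncating the matrix to that set of indices.
\<close>

text \<open>Here \<open>l\<close> is the row and \<open>j\<close> the column: the image of the basis
  vector at the final height \<open>j\<close> has this entry at the initial height \<open>l\<close>,
  so the operators trace paths from end to start. The value 0 off the band allows sums over any
  finite set of heights.\<close>

definition step_entry :: "int \<Rightarrow> int \<Rightarrow> (int \<Rightarrow> int \<Rightarrow> complex) \<Rightarrow> int \<Rightarrow> int \<Rightarrow> complex" where
  "step_entry p q a l j =
     (if - p \<le> j - l \<and> j - l \<le> q then if l \<le> j then a (j - l) l else a (j - l) j else 0)"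

text \<open>Taking \<open>I\<close> as \<open>UNIV\<close>, \<open>{0..}\<close> or
  \<open>{1..}\<close> covers all three families of paths at once.\<close>

definition paths_in :: "int set \<Rightarrow> int \<Rightarrow> int \<Rightarrow> nat \<Rightarrow> int \<Rightarrow> int \<Rightarrow> (nat \<times> int) list set" where
  "paths_in I p q n i j = {\<gamma> \<in> paths_P p q n i j. \<forall>v \<in> set \<gamma>. snd v \<in> I}"

definition path_sum ::
  "int set \<Rightarrow> int \<Rightarrow> int \<Rightarrow> (int \<Rightarrow> int \<Rightarrow> complex) \<Rightarrow> nat \<Rightarrow> int \<Rightarrow> int \<Rightarrow> complex" where
  "path_sum I p q a n i j = (\<Sum>\<gamma> \<in> paths_in I p q n i j. path_weight a \<gamma>)"

lemma finite_paths_in: "finite (paths_in I p q n i j)"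
  by (simp add: paths_in_def finite_paths_P)

text \<open>The last vertex is itself a vertex of the path. This allows the recursion to run over
  the full band of heights even when paths are confined to \<open>I\<close>.\<close>

lemma path_sum_outside: "j \<notin> I \<Longrightarrow> path_sum I p q a n i j = 0"
proof -
  assume "j \<notin> I"
  then have "paths_in I p q n i j = {}"
    by (force simp: paths_in_def paths_P_def lattice_path_def dest: last_in_set)
  then show ?thesis by (simp add: path_sum_def)
qed

lemma lattice_path_snoc:
  assumes "\<gamma> \<noteq> []"
  shows "lattice_path p q (\<gamma> @ [v]) \<longleftrightarrow> lattice_path p q \<gamma> \<and> is_step p q (last \<gamma>) v"
proof -
  obtain n where n: "length \<gamma> = Suc n" using assms by (cases \<gamma>) auto
  then have "last \<gamma> = \<gamma> ! n" using assms by (simp add: last_conv_nth)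
  then show ?thesis using assms n
    by (simp add: lattice_path_def nth_append All_less_Suc conj_commute)
qed

lemma path_weight_snoc:
  assumes "\<gamma> \<noteq> []"
  shows "path_weight a (\<gamma> @ [v]) = path_weight a \<gamma> * step_weight a (last \<gamma>) v"
proof -
  obtain n where n: "length \<gamma> = Suc n" using assms by (cases \<gamma>) auto
  then have "last \<gamma> = \<gamma> ! n" using assms by (simp add: last_conv_nth)
  then show ?thesis using n by (simp add: path_weight_def path_length_def nth_append)
qed

lemma paths_in_0: "paths_in I p q 0 i j = (if i = j \<and> i \<in> I then {[(0, i)]} else {})"
proof -
  have "\<gamma> \<in> paths_in I p q 0 i j \<longleftrightarrow> i = j \<and> i \<in> I \<and> \<gamma> = [(0, i)]" for \<gamma>
    by (cases \<gamma>) (auto simp: paths_in_def paths_P_def lattice_path_def path_length_def)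
  then show ?thesis by auto
qed

lemma path_sum_0: "path_sum I p q a 0 i j = (if i = j \<and> i \<in> I then 1 else 0)"
  by (auto simp: path_sum_def paths_in_0 path_weight_def path_length_def)

lemma paths_in_snoc:
  assumes "j \<in> I" "j - l \<in> {- p..q}" "\<gamma> \<in> paths_in I p q n i l"
  shows "\<gamma> @ [(Suc n, j)] \<in> paths_in I p q (Suc n) i j"
proof -
  have ne: "\<gamma> \<noteq> []" using assms(3) by (auto simp: paths_in_def paths_P_def lattice_path_def)
  then show ?thesis using assms
    by (auto simp: paths_in_def paths_P_def lattice_path_snoc is_step_def path_length_def)
qed

lemma paths_in_SucE:
  assumes "\<gamma> \<in> paths_in I p q (Suc n) i j"
  obtains l \<gamma>' where "\<gamma> = \<gamma>' @ [(Suc n, j)]" "\<gamma>' \<in> paths_in I p q n i l" "j - l \<in> {- p..q}"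
proof -
  have \<gamma>: "\<gamma> \<noteq> []" "length \<gamma> = Suc (Suc n)" "last \<gamma> = (Suc n, j)"
    using assms by (auto simp: paths_in_def paths_P_def lattice_path_def path_length_def)
  define \<gamma>' where "\<gamma>' = butlast \<gamma>"
  have eq: "\<gamma> = \<gamma>' @ [(Suc n, j)]" using \<gamma> append_butlast_last_id[of \<gamma>] by (simp add: \<gamma>'_def)
  have len: "length \<gamma>' = Suc n" using \<gamma> by (simp add: \<gamma>'_def)
  then have ne: "\<gamma>' \<noteq> []" by auto
  have path: "lattice_path p q \<gamma>'" and step: "is_step p q (last \<gamma>') (Suc n, j)"
    using assms ne by (auto simp: eq paths_in_def paths_P_def lattice_path_snoc)
  \<comment> \<open>A step raises the first coordinate by exactly 1, so the penultimate vertex has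
    first coordinate \<open>n\<close>.\<close>
  obtain l where l: "last \<gamma>' = (n, l)"
    using step by (cases "last \<gamma>'") (auto simp: is_step_def)
  have "\<gamma>' \<in> paths_in I p q n i l"
    using assms ne len path l by (auto simp: eq paths_in_def paths_P_def path_length_def)
  moreover have "j - l \<in> {- p..q}" using step l by (simp add: is_step_def)
  ultimately show thesis using that eq by blast
qed

lemma path_sum_Suc:
  assumes "j \<in> I"
  shows "path_sum I p q a (Suc n) i j =
    (\<Sum>l \<in> {j - q..j + p}. path_sum I p q a n i l * step_entry p q a l j)"
proof -
  let ?S = "Sigma {j - q..j + p} (paths_in I p q n i)"
  have last: "\<gamma> \<noteq> []" "last \<gamma> = (n, l)" if "\<gamma> \<in> paths_in I p q n i l" for l \<gamma>
    using that by (auto simp: paths_in_def paths_P_def lattice_path_def)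
  have "path_sum I p q a (Suc n) i j = (\<Sum>(l, \<gamma>) \<in> ?S. path_weight a \<gamma> * step_entry p q a l j)"
    unfolding path_sum_def
  \<comment> \<open>Deleting and appending the last vertex are mutually inverse; the index
    \<open>l\<close> of the pair is recovered as the height of the penultimate vertex.\<close>
  proof (rule sum.reindex_bij_witness[where j = "\<lambda>\<gamma>. (snd (last (butlast \<gamma>)), butlast \<gamma>)"
        and i = "\<lambda>(l, \<gamma>). \<gamma> @ [(Suc n, j)]"], goal_cases)
    case (1 \<gamma>)
    then show ?case by (elim paths_in_SucE) simp
  next
    case (2 \<gamma>)
    then obtain l \<gamma>' where "\<gamma> = \<gamma>' @ [(Suc n, j)]" "\<gamma>' \<in> paths_in I p q n i l" "j - l \<in> {- p..q}"
      by (rule paths_in_SucE)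
    then show ?case using last[of \<gamma>' l] by auto
  next
    case (3 b)
    then show ?case by (auto dest: last)
  next
    case (4 b)
    then show ?case using assms by (auto intro!: paths_in_snoc[where l = "fst b"])
  next
    case (5 \<gamma>)
    then show ?case
      by (elim paths_in_SucE)
        (auto dest: last simp: path_weight_snoc step_weight_def step_entry_def Let_def)
  qed
  also have "\<dots> = (\<Sum>l \<in> {j - q..j + p}. path_sum I p q a n i l * step_entry p q a l j)"
    by (simp add: sum.Sigma[symmetric] finite_paths_in path_sum_def sum_distrib_right)
  finally show ?thesis .
qed

text \<open>
  The matrix indices are the heights shifted by \<open>s\<close>, which is \<open>1\<close> for \<^const>\<open>op_H1\<close> and \<open>0\<close>
  otherwise.
\<close>

lemma lin_ext_funpow_apply:
  assumes b: "\<And>n k. n \<in> J \<Longrightarrow> b n k = (if k \<in> J then step_entry p q a (k + s) (n + s) else 0)"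
    and I: "\<And>n. n + s \<in> I \<longleftrightarrow> n \<in> J"
    and "finite T" "T \<subseteq> J" "\<And>n. n \<notin> T \<Longrightarrow> x n = 0" "i \<in> J"
  shows "(lin_ext J b ^^ n) x i = (\<Sum>l \<in> T. x l * path_sum I p q a n (i + s) (l + s))"
  using assms(3-5)
proof (induction n arbitrary: x T)
  case 0
  have "(\<Sum>l \<in> T. x l * path_sum I p q a 0 (i + s) (l + s)) = (\<Sum>l \<in> T. if l = i then x l else 0)"
    using \<open>i \<in> J\<close> by (intro sum.cong) (auto simp: path_sum_0 I)
  \<comment> \<open>If \<open>i\<close> is not in \<open>T\<close>, both sides vanish because
    \<open>x i = 0\<close>.\<close>
  then show ?case using 0 by simp
next
  case (Suc n)
  let ?K = "\<lambda>k l. step_entry p q a (k + s) (l + s)"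
  let ?P = "\<lambda>n l. path_sum I p q a n (i + s) (l + s)"
  have Lx: "lin_ext J b x k = (\<Sum>l \<in> T. x l * (if k \<in> J then ?K k l else 0))" for k
  proof -
    have "lin_ext J b x = (\<Sum>l \<in> T. x l *\<^sub>s b l)"
      using Suc.prems by (intro lin_ext_superset) auto
    then show ?thesis using Suc.prems(2) b
      by (auto simp: sum_seq_apply scale_seq_def intro!: sum.cong)
  qed
  \<comment> \<open>A finite set of indices containing the support of the image of \<open>x\<close>:
    the band around each \<open>l\<close> in \<open>T\<close>, cut down to \<open>J\<close>.\<close>
  define U where "U = J \<inter> (\<Union>l \<in> T. {l - q..l + p})"
  have U: "finite U" "U \<subseteq> J" using Suc.prems by (auto simp: U_def)
  have U0: "lin_ext J b x k = 0" if "k \<notin> U" for k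
    unfolding Lx using that by (intro sum.neutral) (auto simp: U_def step_entry_def)
  have rec: "(\<Sum>k \<in> U. ?K k l * ?P n k) = ?P (Suc n) l" if "l \<in> T" for l
  proof -
    have "?P (Suc n) l = (\<Sum>k \<in> {l + s - q..l + s + p}.
        path_sum I p q a n (i + s) k * step_entry p q a k (l + s))"
      using that Suc.prems I by (intro path_sum_Suc) auto
    also have "\<dots> = (\<Sum>k \<in> {l - q..l + p}. ?K k l * ?P n k)"
      by (rule sum.reindex_bij_witness[of _ "\<lambda>k. k + s" "\<lambda>k. k - s"]) auto
    also have "\<dots> = (\<Sum>k \<in> U \<inter> {l - q..l + p}. ?K k l * ?P n k)"
    proof (rule sum.mono_neutral_right)
      \<comment> \<open>Since \<open>l\<close> lies in \<open>T\<close>, a band index missing from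
        \<open>U\<close> lies outside \<open>J\<close>; its shifted height is not in
        \<open>I\<close>, so no path ends there.\<close>
      show "\<forall>k \<in> {l - q..l + p} - U \<inter> {l - q..l + p}. ?K k l * ?P n k = 0"
        using that I by (auto simp: U_def intro!: path_sum_outside)
    qed auto
    \<comment> \<open>The further indices in \<open>U\<close> come from bands around other elements
      of \<open>T\<close>, where the entry for \<open>l\<close> is 0.\<close>
    also have "\<dots> = (\<Sum>k \<in> U. ?K k l * ?P n k)"
      by (rule sum.mono_neutral_left) (use U in \<open>auto simp: step_entry_def\<close>)
    finally show ?thesis by simp
  qed
  have "(lin_ext J b ^^ Suc n) x i = (lin_ext J b ^^ n) (lin_ext J b x) i"
    by (simp only: funpow_Suc_right o_apply)
  also have "\<dots> = (\<Sum>k \<in> U. lin_ext J b x k * ?P n k)"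
    by (rule Suc.IH) (use U U0 in auto)
  also have "\<dots> = (\<Sum>k \<in> U. \<Sum>l \<in> T. x l * (?K k l * ?P n k))"
    using U by (intro sum.cong) (auto simp: Lx sum_distrib_right mult.assoc)
  also have "\<dots> = (\<Sum>l \<in> T. x l * (\<Sum>k \<in> U. ?K k l * ?P n k))"
    by (subst sum.swap) (simp add: sum_distrib_left)
  also have "\<dots> = (\<Sum>l \<in> T. x l * ?P (Suc n) l)"
    by (intro sum.cong) (auto simp: rec)
  finally show ?case .
qed

lemma lin_ext_funpow_e:
  assumes "\<And>n k. n \<in> J \<Longrightarrow> b n k = (if k \<in> J then step_entry p q a (k + s) (n + s) else 0)"
    and "\<And>n. n + s \<in> I \<longleftrightarrow> n \<in> J" and "i \<in> J" "j \<in> J"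
  shows "ell2_inner ((lin_ext J b ^^ n) (e j)) (e i) = path_sum I p q a n (i + s) (j + s)"
  using lin_ext_funpow_apply[OF assms(1,2), of "{j}" "e j" i n] assms(3,4)
  unfolding ell2_inner_e by (simp add: e_def)

text \<open>With \<open>sum_e_add_apply\<close>, this reads off the coordinates in the definitions
  of the operators, reducing the matrix hypothesis of \<open>lin_ext_funpow_e\<close> to a case
  distinction.\<close>

lemma sum_e_diff_apply:
  "finite M \<Longrightarrow> (\<Sum>m \<in> M. c m *\<^sub>s e (n - m)) k = (if n - k \<in> M then c (n - k) else 0)"
proof -
  assume "finite M"
  have "(\<Sum>m \<in> M. c m *\<^sub>s e (n - m)) k = (\<Sum>m \<in> M. if m = n - k then c m else 0)"
    unfolding sum_seq_apply by (intro sum.cong) (auto simp: scale_seq_def e_def)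
  then show ?thesis using \<open>finite M\<close> by simp
qed

lemma sum_e_add_apply:
  "finite M \<Longrightarrow> (\<Sum>m \<in> M. c m *\<^sub>s e (n + m)) k = (if k - n \<in> M then c (k - n) else 0)"
proof -
  assume "finite M"
  have "(\<Sum>m \<in> M. c m *\<^sub>s e (n + m)) k = (\<Sum>m \<in> M. if m = k - n then c m else 0)"
    unfolding sum_seq_apply by (intro sum.cong) (auto simp: scale_seq_def e_def)
  then show ?thesis using \<open>finite M\<close> by simp
qed

lemma op_W_funpow_e:
  assumes "p \<ge> 0" "q \<ge> 0"
  shows "ell2_inner ((op_W p q a ^^ n) (e j)) (e i) = path_sum UNIV p q a n i j"
proof -
  \<comment> \<open>The added zeros let the shift \<open>s\<close> unify with 0.\<close>
  have "ell2_inner ((op_W p q a ^^ n) (e j)) (e i) = path_sum UNIV p q a n (i + 0) (j + 0)"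
    unfolding op_W_def using assms
    by (intro lin_ext_funpow_e)
      (auto simp: sum_e_diff_apply sum_e_add_apply step_entry_def)
  then show ?thesis by simp
qed

text \<open>The bound \<open>min n q\<close> keeps exactly the terms with \<open>n - m\<close>
  nonnegative, which is truncation to \<open>{0..}\<close>; the terms at \<open>n + m\<close> stay
  there anyway.\<close>

lemma op_H_funpow_e:
  assumes "p \<ge> 0" "q \<ge> 0" "i \<ge> 0" "j \<ge> 0"
  shows "ell2_inner ((op_H p q a ^^ n) (e j)) (e i) = path_sum {0..} p q a n i j"
proof -
  have "ell2_inner ((op_H p q a ^^ n) (e j)) (e i) = path_sum {0..} p q a n (i + 0) (j + 0)"
    unfolding op_H_def using assms
    by (intro lin_ext_funpow_e)
      (auto simp: sum_e_diff_apply sum_e_add_apply step_entry_def)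
  then show ?thesis by simp
qed

text \<open>The coefficients of \<open>op_H1\<close> are those of steps between heights one above
  the basis indices, hence the shift 1 and the floor \<open>{1..}\<close>.\<close>

lemma op_H1_funpow_e:
  assumes "p \<ge> 0" "q \<ge> 0" "i \<ge> 0" "j \<ge> 0"
  shows "ell2_inner ((op_H1 p q a ^^ n) (e j)) (e i) = path_sum {1..} p q a n (i + 1) (j + 1)"
  unfolding op_H1_def using assms
  by (intro lin_ext_funpow_e)
    (auto simp: sum_e_diff_apply sum_e_add_apply step_entry_def)

lemma W_sum_eq_path_sum: "W_sum p q a n i j = path_sum UNIV p q a n i j"
  by (simp add: W_sum_def path_sum_def paths_in_def)

lemma A_sum_eq_path_sum: "A_sum p q a n i j = path_sum {0..} p q a n i j"
  by (simp add: A_sum_def path_sum_def paths_in_def paths_D_def)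

lemma A1_sum_eq_path_sum: "A1_sum p q a n i j = path_sum {1..} p q a n (i + 1) (j + 1)"
proof -
  have "paths_D1 p q n i j = paths_in {1..} p q n (i + 1) (j + 1)"
    by (force simp: paths_D1_def paths_D_def paths_in_def)
  then show ?thesis by (simp add: A1_sum_def path_sum_def)
qed

theorem theorem3p1:
  fixes p q :: int and a :: "int \<Rightarrow> int \<Rightarrow> complex"
  assumes "p \<ge> 1" and "q \<ge> 1"
  shows "(\<forall>i j :: int. i \<ge> 0 \<longrightarrow> j \<ge> 0 \<longrightarrow> phi p q a i j = A_series p q a i j) \<and>
         (\<forall>i j :: int. i \<ge> 0 \<longrightarrow> j \<ge> 0 \<longrightarrow> phi1 p q a i j = A1_series p q a i j) \<and>
         (\<forall>i j :: int. psi p q a i j = W_series p q a i j)"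
  \<comment> \<open>The series agree coefficient by coefficient: operator side and path side both
    rewrite to the same \<open>path_sum\<close>.\<close>
  using assms
  by (simp add: phi_def A_series_def op_H_funpow_e A_sum_eq_path_sum
      phi1_def A1_series_def op_H1_funpow_e A1_sum_eq_path_sum
      psi_def W_series_def op_W_funpow_e W_sum_eq_path_sum)

end
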